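(* Let $R$ be a von Neumann regular ring with identity and let $a,b,c\in R$. Let $e,f\in R$ be idempotents such that $eR=aR\cap cR$ and $Rf=Ra\cap Rb$. Put $S=eRf$, assume $a\notin S$, and let $C=\{s\in eRf : s\leq^{\oplus} a\}$. Let $a^{(1)}$ be any von Neumann inverse of $a$. Then the set $\max C$ of maximal elements of $C$ is $$\max C=\{evf : v\in R \text{ is a strong von Neumann inverse of } fa^{(1)}e\}.$$
   Context: A ring $R$ with identity is von Neumann regular if for every $r\in R$ there is $x\in R$ with $rxr=r$. An element $x$ with $rxr=r$ is called a von Neumann inverse of $r$. An element $x$ is a strong von Neumann inverse of $r$ if $rxr=r$ and $xrx=x$. The direct sum partial order on $R$: $p\leq^{\oplus} q$ means $qR=pR\oplus (q-p)R$ (that is, $qR=pR+(q-p)R$ and $pR\cap(q-p)R=(0)$). A maximal element of $C=\{s\in S : s\leq^{\oplus} a\}$ is an element $m\in C$, $m\neq a$, such that whenever $d\in S$ satisfies $m\leq^{\oplus} d\leq^{\oplus} a$, then $d=m$ or $d=a$. $\max C$ denotes the set of all maximal elements of $C$. *)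

theory Defs
  imports "HOL-Library.Set_Algebras"
begin

definition vn_inverse :: "'a::ring_1 \<Rightarrow> 'a \<Rightarrow> bool" where
  "vn_inverse r x \<longleftrightarrow> r * x * r = r"

definition strong_vn_inverse :: "'a::ring_1 \<Rightarrow> 'a \<Rightarrow> bool" where
  "strong_vn_inverse r x \<longleftrightarrow> r * x * r = r \<and> x * r * x = x"

(* The zero ring is not an instance of ring_1. *)
class vn_regular_ring = ring_1 +
  assumes vn_regular: "\<exists>x. r * x * r = r"

definition principal_right_ideal :: "'a::ring_1 \<Rightarrow> 'a set" where
  "principal_right_ideal p = {p * r | r. True}"

definition principal_left_ideal :: "'a::ring_1 \<Rightarrow> 'a set" where
  "principal_left_ideal p = {r * p | r. True}"

definition corner :: "'a::ring_1 \<Rightarrow> 'a \<Rightarrow> 'a set" where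
  "corner e f = {e * r * f | r. True}"

(* The sum of the two ideals is the elementwise sum of sets from Set_Algebras. *)
definition direct_sum_le :: "'a::ring_1 \<Rightarrow> 'a \<Rightarrow> bool"  (infix "\<le>\<^sup>\<oplus>" 50) where
  "p \<le>\<^sup>\<oplus> q \<longleftrightarrow>
     principal_right_ideal q = principal_right_ideal p + principal_right_ideal (q - p) \<and>
     principal_right_ideal p \<inter> principal_right_ideal (q - p) = {0}"

definition below :: "'a::ring_1 set \<Rightarrow> 'a \<Rightarrow> 'a set" where
  "below S a = {s \<in> S. s \<le>\<^sup>\<oplus> a}"

(* The maximal elements of below S a. The element a itself is excluded, so this is
   maximality among the elements other than a. *)
definition max_below :: "'a::ring_1 set \<Rightarrow> 'a \<Rightarrow> 'a set" where
  "max_below S a =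
     {m \<in> below S a. m \<noteq> a \<and>
        (\<forall>d\<in>S. m \<le>\<^sup>\<oplus> d \<and> d \<le>\<^sup>\<oplus> a \<longrightarrow> d = m \<or> d = a)}"

end

theory Submission
  imports Defs
begin

text \<open>
  Fix an inner inverse \<open>x\<close> of \<open>q\<close>. The order \<open>p \<le>\<^sup>\<oplus> q\<close> then says that multiplication by
  \<open>q * x\<close> on the left and by \<open>x * q\<close> on the right fixes \<open>p\<close>, and that \<open>x\<close> is an inner inverse
  of \<open>p\<close> as well (\<open>direct_sum_le_iff\<close>). So one inner inverse \<open>a1\<close> of \<open>a\<close> describes the order
  between all elements below \<open>a\<close>, because it is an inner inverse of each of them.

  The hypotheses on the ideals give \<open>a * a1 * e = e\<close> and \<open>f * a1 * a = f\<close>. For \<open>s\<close> in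
  \<open>eRf\<close> these equations reduce \<open>s \<le>\<^sup>\<oplus> a\<close> to \<open>s * g * s = s\<close> with \<open>g = f * a1 * e\<close>: the elements
  of \<open>C\<close> are the outer inverses of \<open>g\<close> in \<open>eRf\<close>. If an outer inverse \<open>m\<close> is also an inner
  inverse of \<open>g\<close>, nothing lies strictly above it, since \<open>d = d * g * d = d * g * m * g * d = m\<close>
  for every \<open>d\<close> above \<open>m\<close>. If it is not, then the defect \<open>g - g * m * g\<close> is nonzero, and
  regularity supplies a nonzero outer inverse of it that can be added to \<open>m\<close> orthogonally
  (\<open>outer_inverse_extension\<close>); the sum is a strictly larger element of \<open>C\<close>. Hence the maximal
  elements are the strong inverses of \<open>g\<close> that lie in \<open>eRf\<close>, and compressing an arbitrary
  strong inverse \<open>v\<close> to \<open>e * v * f\<close> yields exactly these.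
\<close>

section \<open>Principal ideals and corners\<close>

lemma mult_mem_principal_right_ideal: "p * r \<in> principal_right_ideal p"
  by (auto simp: principal_right_ideal_def)

lemma mem_principal_right_ideal_self: "p \<in> principal_right_ideal p"
  using mult_mem_principal_right_ideal[of p 1] by simp

lemma mem_principal_left_ideal_self: "p \<in> principal_left_ideal p"
  unfolding principal_left_ideal_def by (metis (mono_tags, lifting) mem_Collect_eq mult_1)

lemma principal_right_ideal_fixed:
  assumes "q * x * q = q" and "p \<in> principal_right_ideal q"
  shows "q * x * p = p"
  using assms by (auto simp: principal_right_ideal_def mult.assoc[symmetric])

lemma principal_left_ideal_fixed:
  assumes "q * x * q = q" and "p \<in> principal_left_ideal q"
  shows "p * x * q = p"
  using assms by (auto simp: principal_left_ideal_def mult.assoc)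

lemma mem_corner_iff:
  assumes "e * e = e" and "f * f = f"
  shows "s \<in> corner e f \<longleftrightarrow> e * s = s \<and> s * f = s"
proof
  assume "s \<in> corner e f"
  then show "e * s = s \<and> s * f = s"
    using assms by (auto simp: corner_def mult.assoc) (simp add: mult.assoc[symmetric])
next
  assume "e * s = s \<and> s * f = s"
  then have "s = e * s * f" by simp
  then show "s \<in> corner e f" unfolding corner_def by blast
qed

section \<open>The direct sum order in terms of an inner inverse\<close>

text \<open>
  Given the direct sum, \<open>p\<close> lies in \<open>qR\<close>, and the other two equations come from decomposing
  \<open>p\<close> and \<open>q\<close> in two ways along \<open>pR\<close> and \<open>(q - p)R\<close>. Conversely, multiplication by \<open>p * x\<close> on
  the left is the identity on \<open>pR\<close> and vanishes on \<open>(q - p)R\<close>.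
\<close>
lemma direct_sum_le_iff:
  fixes p q x :: "'a::ring_1"
  assumes inv: "q * x * q = q"
  shows "p \<le>\<^sup>\<oplus> q \<longleftrightarrow> q * x * p = p \<and> p * x * q = p \<and> p * x * p = p"
proof
  assume le: "p \<le>\<^sup>\<oplus> q"
  let ?P = "principal_right_ideal p" and ?D = "principal_right_ideal (q - p)"
  have disjoint: "y = 0" if "y \<in> ?P" "y \<in> ?D" for y
    using le that unfolding direct_sum_le_def by blast
  have "p + (q - p) * 0 \<in> ?P + ?D"
    by (intro set_plus_intro mult_mem_principal_right_ideal mem_principal_right_ideal_self)
  then have "p \<in> principal_right_ideal q"
    using le unfolding direct_sum_le_def by simp
  then have qp: "q * x * p = p"
    by (rule principal_right_ideal_fixed[OF inv])
  \<comment> \<open>two decompositions of \<open>p = q * x * p\<close>\<close>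
  have "p * (1 - x * p) = (q - p) * (x * p)"
    using qp by (simp add: algebra_simps)
  then have "p * (1 - x * p) = 0"
    using disjoint mult_mem_principal_right_ideal by metis
  then have pp: "p * x * p = p"
    by (simp add: algebra_simps)
  \<comment> \<open>two decompositions of \<open>q = q * x * q\<close>\<close>
  have "p * (x * q - 1) = (q - p) * (1 - x * q)"
    using inv by (simp add: algebra_simps)
  then have "p * (x * q - 1) = 0"
    using disjoint mult_mem_principal_right_ideal by metis
  then have "p * x * q = p"
    by (simp add: algebra_simps)
  with qp pp show "q * x * p = p \<and> p * x * q = p \<and> p * x * p = p"
    by blast
next
  assume "q * x * p = p \<and> p * x * q = p \<and> p * x * p = p"
  then have qp: "q * x * p = p" and pq: "p * x * q = p" and pp: "p * x * p = p"
    by auto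
  let ?P = "principal_right_ideal p" and ?D = "principal_right_ideal (q - p)"
  have "principal_right_ideal q = ?P + ?D"
  proof
    show "principal_right_ideal q \<subseteq> ?P + ?D"
    proof
      fix y assume "y \<in> principal_right_ideal q"
      then obtain r where "y = q * r" by (auto simp: principal_right_ideal_def)
      then have "y = p * r + (q - p) * r" by (simp add: algebra_simps)
      then show "y \<in> ?P + ?D"
        by (auto intro: set_plus_intro mult_mem_principal_right_ideal)
    qed
  next
    show "?P + ?D \<subseteq> principal_right_ideal q"
    proof
      fix y assume "y \<in> ?P + ?D"
      then obtain r s where "y = p * r + (q - p) * s"
        by (auto elim!: set_plus_elim simp: principal_right_ideal_def)
      also have "\<dots> = (q * x * p) * r + (q - q * x * p) * s" by (simp only: qp)
      also have "\<dots> = q * (x * p * r + (1 - x * p) * s)" by (simp add: algebra_simps)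
      finally show "y \<in> principal_right_ideal q"
        by (simp only: mult_mem_principal_right_ideal)
    qed
  qed
  moreover have "y = 0" if y: "y \<in> ?P" "y \<in> ?D" for y
  proof -
    obtain r where r: "y = p * r" using y(1) by (auto simp: principal_right_ideal_def)
    obtain s where s: "y = (q - p) * s" using y(2) by (auto simp: principal_right_ideal_def)
    have "y = p * x * y" using pp r by (simp add: mult.assoc[symmetric])
    also have "\<dots> = p * x * ((q - p) * s)" by (simp only: s)
    also have "\<dots> = (p * x * q - p * x * p) * s" by (simp add: algebra_simps)
    also have "\<dots> = 0" using pq pp by simp
    finally show ?thesis .
  qed
  moreover have "0 \<in> ?P" "0 \<in> ?D"
    using mult_mem_principal_right_ideal[of _ 0] by simp_all
  ultimately show "p \<le>\<^sup>\<oplus> q"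
    unfolding direct_sum_le_def by blast
qed

section \<open>Outer and strong inverses in a corner\<close>

lemma vn_regular_strong_inverse:
  fixes r :: "'a::vn_regular_ring"
  obtains y where "strong_vn_inverse r y"
proof -
  obtain x where x: "r * x * r = r" using vn_regular by blast
  have "strong_vn_inverse r (x * r * x)"
    unfolding strong_vn_inverse_def using x by (metis mult.assoc)
  then show thesis by (rule that)
qed

text \<open>
  Compression to the corner does not change products with \<open>g = f * g * e\<close> on both sides.
\<close>
lemma strong_vn_inverse_compress:
  assumes "e * e = e" and "f * f = f" and "f * g = g" and "g * e = g"
    and "strong_vn_inverse g v"
  shows "strong_vn_inverse g (e * v * f)"
proof -
  have gvg: "g * v * g = g" and vgv: "v * g * v = v"
    using assms(5) by (auto simp: strong_vn_inverse_def)
  have "g * (e * v * f) * g = (g * e) * v * (f * g)" by (simp add: mult.assoc)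
  then have inner: "g * (e * v * f) * g = g" using assms gvg by simp
  have "(e * v * f) * g * (e * v * f) = e * v * (f * g) * e * v * f"
    by (simp add: mult.assoc)
  also have "\<dots> = e * v * (g * e) * v * f" using assms by (simp add: mult.assoc)
  also have "\<dots> = e * (v * g * v) * f" using assms by (simp add: mult.assoc)
  finally have "(e * v * f) * g * (e * v * f) = e * v * f" using vgv by simp
  with inner show ?thesis by (simp add: strong_vn_inverse_def)
qed

text \<open>
  The defect \<open>h = g - g * m * g\<close> equals \<open>(1 - g * m) * g * (1 - m * g)\<close>, with \<open>g * m\<close> and
  \<open>m * g\<close> idempotent. So a strong inverse \<open>u\<close> of \<open>h\<close>, multiplied by \<open>1 - m * g\<close> on the left and
  by \<open>1 - g * m\<close> on the right, becomes an outer inverse \<open>w\<close> of \<open>g\<close> that is orthogonal to \<open>m\<close>.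
  The last conclusion guarantees that \<open>w\<close> is nonzero unless \<open>h = 0\<close>.
\<close>
lemma outer_inverse_extension:
  fixes e f g m :: "'a::vn_regular_ring"
  assumes idem: "e * e = e" "f * f = f"
    and g: "f * g = g" "g * e = g"
    and m: "e * m = m" "m * f = m" and outer: "m * g * m = m"
  obtains w where "e * w = w" "w * f = w" "m * g * w = 0" "w * g * m = 0" "w * g * w = w"
    "(g - g * m * g) * w * (g - g * m * g) = g - g * m * g"
proof -
  define h where "h = g - g * m * g"
  have h_corner: "f * h = h" "h * e = h"
    unfolding h_def using g by (simp_all add: algebra_simps) (simp add: mult.assoc[symmetric])
  have mg: "m * (g * (m * y)) = m * y" for y
    using outer by (metis mult.assoc)
  have outer': "m * (g * m) = m"
    using outer by (simp add: mult.assoc)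
  have h_factor: "(1 - g * m) * g * (1 - m * g) = h"
    unfolding h_def by (simp add: algebra_simps mg)
  have h_absorb: "h * (1 - m * g) = h" "(1 - g * m) * h = h"
    unfolding h_def by (simp_all add: algebra_simps mg)
  obtain u0 where "strong_vn_inverse h u0"
    by (rule vn_regular_strong_inverse)
  then have "strong_vn_inverse h (e * u0 * f)"
    by (rule strong_vn_inverse_compress[OF idem h_corner])
  moreover define u where "u = e * u0 * f"
  ultimately have huh: "h * u * h = h" and uhu: "u * h * u = u"
    by (auto simp: strong_vn_inverse_def)
  have u: "e * u = u" "u * f = u"
    unfolding u_def using idem by (simp_all add: mult.assoc) (simp add: mult.assoc[symmetric])
  define w where "w = (1 - m * g) * u * (1 - g * m)"
  have "e * (1 - m * g) = e - m * g"
    using m(1) by (simp add: right_diff_distrib mult.assoc[symmetric])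
  also have "\<dots> * u = (1 - m * g) * u"
    using u(1) by (simp add: left_diff_distrib)
  finally have "e * (1 - m * g) * u = (1 - m * g) * u" .
  then have ew: "e * w = w"
    unfolding w_def by (simp add: mult.assoc[symmetric])
  have "u * ((1 - g * m) * f) = u * (1 - g * m)"
    using m(2) u(2) by (simp add: algebra_simps)
  then have wf: "w * f = w"
    unfolding w_def by (simp add: mult.assoc)
  have mgw: "m * g * w = 0"
  proof -
    have "m * g * (1 - m * g) = 0" by (simp add: algebra_simps mg)
    then show ?thesis unfolding w_def by (simp add: mult.assoc[symmetric])
  qed
  have wgm: "w * g * m = 0"
  proof -
    have "(1 - g * m) * (g * m) = 0" by (simp add: algebra_simps outer')
    then show ?thesis unfolding w_def by (simp add: mult.assoc)
  qed
  have "w * g * w = (1 - m * g) * u * ((1 - g * m) * g * (1 - m * g)) * u * (1 - g * m)"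
    unfolding w_def by (simp only: mult.assoc)
  also have "\<dots> = (1 - m * g) * (u * h * u) * (1 - g * m)"
    by (simp only: h_factor[symmetric] mult.assoc)
  finally have wgw: "w * g * w = w"
    by (simp only: uhu w_def)
  have "h * w * h = (h * (1 - m * g)) * u * ((1 - g * m) * h)"
    unfolding w_def by (simp only: mult.assoc)
  then have "h * w * h = h"
    by (simp only: h_absorb huh)
  with ew wf mgw wgm wgw show thesis
    using that unfolding h_def by blast
qed

section \<open>Maximal elements below \<open>a\<close>\<close>

theorem theorem13:
  fixes a b c e f a1 :: "'a::vn_regular_ring"
  assumes "e * e = e"
    and "f * f = f"
    and "principal_right_ideal e = principal_right_ideal a \<inter> principal_right_ideal c"
    and "principal_left_ideal f = principal_left_ideal a \<inter> principal_left_ideal b"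
    and "a \<notin> corner e f"
    and "vn_inverse a a1"
  shows "max_below (corner e f) a = {e * v * f | v. strong_vn_inverse (f * a1 * e) v}"
proof -
  define g where "g = f * a1 * e"
  have a1: "a * a1 * a = a"
    using assms(6) by (simp add: vn_inverse_def)
  have "e \<in> principal_right_ideal a"
    using mem_principal_right_ideal_self[of e] assms(3) by blast
  then have ae: "a * a1 * e = e"
    by (rule principal_right_ideal_fixed[OF a1])
  have "f \<in> principal_left_ideal a"
    using mem_principal_left_ideal_self[of f] assms(4) by blast
  then have fa: "f * a1 * a = f"
    by (rule principal_left_ideal_fixed[OF a1])
  have g: "f * g = g" "g * e = g"
    unfolding g_def using assms(1,2) by (simp_all add: mult.assoc) (simp add: mult.assoc[symmetric])
  note corner_iff = mem_corner_iff[OF assms(1,2)]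
  have sandwich: "s * a1 * t = s * g * t" if "s \<in> corner e f" "t \<in> corner e f" for s t
  proof -
    have "s * a1 * t = (s * f) * a1 * (e * t)" using that corner_iff by simp
    then show ?thesis unfolding g_def by (simp only: mult.assoc)
  qed
  have le_a_iff: "s \<le>\<^sup>\<oplus> a \<longleftrightarrow> s * g * s = s" if s: "s \<in> corner e f" for s
  proof -
    have es: "e * s = s" and sf: "s * f = s" using s corner_iff by auto
    have "a * a1 * s = s" using ae es by (metis mult.assoc)
    moreover have "s * a1 * a = s" using fa sf by (metis mult.assoc)
    ultimately show ?thesis
      using direct_sum_le_iff[OF a1, of s] sandwich[OF s s] by simp
  qed
  \<comment> \<open>every element of \<open>C\<close> has \<open>a1\<close> as an inner inverse\<close>
  have le_iff: "s \<le>\<^sup>\<oplus> d \<longleftrightarrow> d * g * s = s \<and> s * g * d = s \<and> s * g * s = s"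
    if s: "s \<in> corner e f" and d: "d \<in> corner e f" and dgd: "d * g * d = d" for s d
  proof -
    have "d * a1 * d = d" using sandwich[OF d d] dgd by simp
    from direct_sum_le_iff[OF this, of s] show ?thesis
      by (simp only: sandwich[OF s s] sandwich[OF s d] sandwich[OF d s])
  qed
  have "m \<in> max_below (corner e f) a \<longleftrightarrow> m \<in> corner e f \<and> strong_vn_inverse g m" for m
  proof
    assume max: "m \<in> max_below (corner e f) a"
    then have mS: "m \<in> corner e f" and "m \<le>\<^sup>\<oplus> a"
      by (auto simp: max_below_def below_def)
    then have outer: "m * g * m = m" using le_a_iff by simp
    have m: "e * m = m" "m * f = m" using mS corner_iff by auto
    obtain w where w: "e * w = w" "w * f = w" "m * g * w = 0" "w * g * m = 0" "w * g * w = w"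
      and defect: "(g - g * m * g) * w * (g - g * m * g) = g - g * m * g"
      by (rule outer_inverse_extension[OF assms(1,2) g m outer])
    have dS: "m + w \<in> corner e f"
      using corner_iff m w by (simp add: algebra_simps)
    have dgd: "(m + w) * g * (m + w) = m + w"
      using outer w by (simp add: distrib_left distrib_right)
    have "m \<le>\<^sup>\<oplus> m + w"
      using le_iff[OF mS dS dgd] outer w by (simp add: distrib_left distrib_right)
    moreover have "m + w \<le>\<^sup>\<oplus> a" using le_a_iff[OF dS] dgd by simp
    ultimately have "m + w = m \<or> m + w = a"
      using max dS unfolding max_below_def by blast
    then have "w = 0" using dS assms(5) by auto
    then have "g * m * g = g" using defect by simp
    with mS outer show "m \<in> corner e f \<and> strong_vn_inverse g m"
      by (simp add: strong_vn_inverse_def)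
  next
    assume "m \<in> corner e f \<and> strong_vn_inverse g m"
    then have mS: "m \<in> corner e f" and outer: "m * g * m = m" and inner: "g * m * g = g"
      by (auto simp: strong_vn_inverse_def)
    have "d = m" if dS: "d \<in> corner e f" and md: "m \<le>\<^sup>\<oplus> d" and da: "d \<le>\<^sup>\<oplus> a" for d
    proof -
      have dgd: "d * g * d = d" using le_a_iff[OF dS] da by simp
      then have dgm: "d * g * m = m" and mgd: "m * g * d = m"
        using le_iff[OF mS dS dgd] md by auto
      have "d = d * (g * m * g) * d" using inner dgd by simp
      also have "\<dots> = (d * g * m) * g * d" by (simp only: mult.assoc)
      also have "\<dots> = m" by (simp only: dgm mgd)
      finally show ?thesis .
    qed
    then show "m \<in> max_below (corner e f) a"
      using mS outer le_a_iff[OF mS] assms(5) unfolding max_below_def below_def by blast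
  qed
  moreover have "m \<in> corner e f \<and> strong_vn_inverse g m
      \<longleftrightarrow> (\<exists>v. m = e * v * f \<and> strong_vn_inverse g v)" for m
  proof
    assume "m \<in> corner e f \<and> strong_vn_inverse g m"
    \<comment> \<open>such an \<open>m\<close> is its own compression\<close>
    then show "\<exists>v. m = e * v * f \<and> strong_vn_inverse g v"
      using corner_iff by (intro exI[of _ m]) simp
  next
    assume "\<exists>v. m = e * v * f \<and> strong_vn_inverse g v"
    then show "m \<in> corner e f \<and> strong_vn_inverse g m"
      using strong_vn_inverse_compress[OF assms(1,2) g] by (auto simp: corner_def)
  qed
  ultimately show ?thesis
    unfolding g_def by blast
qed

end
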